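(* Let $X$ be a finite dimensional real linear space, let $W\supset X$ be a finite dimensional linear space, and let $a(\cdot,\cdot)$ be a symmetric positive semidefinite bilinear form on $W$ that is positive definite on $X$. Let $V_1,\dots,V_M$ be subspaces of $W$ with $X\subset\sum_{k=1}^M V_k\subset W$ such that $a(\cdot,\cdot)$ is positive definite on each $V_k$ separately, and let $Q_k:V_k\to X$, $k=1,\dots,M$, be linear operators. Let $B:X'\to X$ be the preconditioner $$B:r\mapsto u=\sum_{k=1}^M Q_kv_k,\qquad v_k\in V_k:\quad a(v_k,z_k)=\langle r,Q_kz_k\rangle\quad\forall z_k\in V_k .$$ For $k=1,\dots,M$ define $$V_k^{\mathcal M}=\left\{v_k\in V_k:\ \forall z_k\in V_k:\ Q_kv_k=Q_kz_k\Longrightarrow\|v_k\|_a^2\le\|z_k\|_a^2\right\}.$$ Suppose there exist constants $C_0,\omega$ and a symmetric matrix $\mathcal E=(e_{ij})_{i,j=1}^M$ such that (i) for every $u\in X$ there exist $v_k\in V_k$, $k=1,\dots,M$, with $u=\sum_{k=1}^MQ_kv_k$ and $\sum_{k=1}^M\|v_k\|_a^2\le C_0\|u\|_a^2$; (ii) for every $k=1,\dots,M$ and every $v_k\in V_k^{\mathcal M}$, $\|Q_kv_k\|_a^2\le\omega\|v_k\|_a^2$; (iii) for all $z_k\in Q_kV_k$, $k=1,\dots,M$, and all $i,j\in\{1,\dots,M\}$, $a(z_i,z_j)\le e_{ij}\|z_i\|_a\|z_j\|_a$. Then $$\kappa=\frac{\lambda_{\max}(BA_X)}{\lambda_{\min}(BA_X)}\le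 C_0\,\omega\,\rho(\mathcal E).$$
   Context: $X'$ is the dual space of $X$ and $\langle\cdot,\cdot\rangle$ the duality pairing. $\|u\|_a=a(u,u)^{1/2}$ is the energy (semi)norm. $A_X:X\to X'$ is the operator defined by $a(u,v)=\langle A_Xu,v\rangle$ for all $u,v\in X$. $\lambda_{\max}(BA_X)$ and $\lambda_{\min}(BA_X)$ are the largest and smallest eigenvalues of $BA_X:X\to X$, and $\rho$ denotes the spectral radius. *)

theory Defs
  imports
    "HOL-Library.FuncSet"
    "HOL-Library.Set_Algebras"
    "Jordan_Normal_Form.Spectral_Radius"
begin

definition finite_dim_subspace :: "'w::real_vector set \<Rightarrow> bool" where
  "finite_dim_subspace S \<longleftrightarrow>
    Real_Vector_Spaces.subspace S \<and> (\<exists>F. finite F \<and> Real_Vector_Spaces.span F = S)"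

definition linear_on :: "'w::real_vector set \<Rightarrow> ('w \<Rightarrow> 'v::real_vector) \<Rightarrow> bool" where
  "linear_on S f \<longleftrightarrow>
    (\<forall>x\<in>S. \<forall>y\<in>S. f (x + y) = f x + f y) \<and> (\<forall>c. \<forall>x\<in>S. f (c *\<^sub>R x) = c *\<^sub>R f x)"

definition bilinear_form_on :: "'w::real_vector set \<Rightarrow> ('w \<Rightarrow> 'w \<Rightarrow> real) \<Rightarrow> bool" where
  "bilinear_form_on S a \<longleftrightarrow>
    (\<forall>x\<in>S. linear_on S (\<lambda>y. a x y)) \<and> (\<forall>y\<in>S. linear_on S (\<lambda>x. a x y))"

definition symmetric_on :: "'w set \<Rightarrow> ('w \<Rightarrow> 'w \<Rightarrow> real) \<Rightarrow> bool" where
  "symmetric_on S a \<longleftrightarrow> (\<forall>x\<in>S. \<forall>y\<in>S. a x y = a y x)"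

definition pos_semidef_on :: "'w set \<Rightarrow> ('w \<Rightarrow> 'w \<Rightarrow> real) \<Rightarrow> bool" where
  "pos_semidef_on S a \<longleftrightarrow> (\<forall>x\<in>S. 0 \<le> a x x)"

definition pos_def_on :: "'w::real_vector set \<Rightarrow> ('w \<Rightarrow> 'w \<Rightarrow> real) \<Rightarrow> bool" where
  "pos_def_on S a \<longleftrightarrow> (\<forall>x\<in>S. x \<noteq> 0 \<longrightarrow> 0 < a x x)"

definition energy_norm :: "('w \<Rightarrow> 'w \<Rightarrow> real) \<Rightarrow> 'w \<Rightarrow> real" where
  "energy_norm a u = sqrt (a u u)"

text \<open>Functionals on \<open>X\<close> are represented by functions that are \<open>undefined\<close> off \<open>X\<close>, so that
  equality of functionals is equality of functions. The duality pairing of \<open>r\<close> and \<open>x\<close> is the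
  application \<open>r x\<close>.\<close>

definition dual_space :: "'w::real_vector set \<Rightarrow> ('w \<Rightarrow> real) set" where
  "dual_space X = {r \<in> extensional X. linear_on X r}"

definition form_op :: "'w set \<Rightarrow> ('w \<Rightarrow> 'w \<Rightarrow> real) \<Rightarrow> 'w \<Rightarrow> ('w \<Rightarrow> real)" where
  "form_op X a u = (\<lambda>v\<in>X. a u v)"

text \<open>The description below is proper whenever \<open>V\<close> is a finite-dimensional subspace, \<open>a\<close> is a
  symmetric bilinear form that is positive definite on \<open>V\<close>, \<open>Q\<close> maps \<open>V\<close> linearly into \<open>X\<close>,
  and \<open>r\<close> lies in \<open>dual_space X\<close> (Riesz representation on \<open>V\<close>).\<close>

definition local_solution ::
  "('w \<Rightarrow> 'w \<Rightarrow> real) \<Rightarrow> 'w set \<Rightarrow> ('w \<Rightarrow> 'w) \<Rightarrow> ('w \<Rightarrow> real) \<Rightarrow> 'w" where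
  "local_solution a V Q r = (THE v. v \<in> V \<and> (\<forall>z\<in>V. a v z = r (Q z)))"

text \<open>The subspaces, operators and matrix entries are indexed by \<open>0, \<dots>, M - 1\<close>.\<close>

definition preconditioner ::
  "'w::real_vector set \<Rightarrow> ('w \<Rightarrow> 'w \<Rightarrow> real) \<Rightarrow> nat \<Rightarrow> (nat \<Rightarrow> 'w set) \<Rightarrow> (nat \<Rightarrow> 'w \<Rightarrow> 'w)
    \<Rightarrow> ('w \<Rightarrow> real) \<Rightarrow> 'w" where
  "preconditioner X a M V Q = (\<lambda>r\<in>dual_space X. \<Sum>k<M. Q k (local_solution a (V k) (Q k) r))"

definition minimal_energy_set ::
  "('w \<Rightarrow> 'w \<Rightarrow> real) \<Rightarrow> 'w set \<Rightarrow> ('w \<Rightarrow> 'w) \<Rightarrow> 'w set" where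
  "minimal_energy_set a V Q =
    {v \<in> V. \<forall>z\<in>V. Q v = Q z \<longrightarrow> (energy_norm a v)\<^sup>2 \<le> (energy_norm a z)\<^sup>2}"

text \<open>Only real eigenvalues are collected. For the operator \<open>preconditioner \<circ> form_op\<close> these are
  all of them, since it is self-adjoint for the inner product \<open>a\<close> on \<open>X\<close>.\<close>

definition eigenvalues_on :: "'w::real_vector set \<Rightarrow> ('w \<Rightarrow> 'w) \<Rightarrow> real set" where
  "eigenvalues_on X T = {l. \<exists>x\<in>X. x \<noteq> 0 \<and> T x = l *\<^sub>R x}"

definition lambda_max :: "'w::real_vector set \<Rightarrow> ('w \<Rightarrow> 'w) \<Rightarrow> real" where
  "lambda_max X T = Max (eigenvalues_on X T)"

definition lambda_min :: "'w::real_vector set \<Rightarrow> ('w \<Rightarrow> 'w) \<Rightarrow> real" where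
  "lambda_min X T = Min (eigenvalues_on X T)"

end

theory Submission
  imports Defs "HOL-Analysis.Function_Topology"
begin

text \<open>Write \<open>v\<^sub>k(u)\<close> for the local solution in \<open>V\<^sub>k\<close> with right-hand side \<open>A\<^sub>X u\<close>, and
  \<open>T = B A\<^sub>X\<close>, so that \<open>T u\<close> is the sum of the \<open>Q\<^sub>k v\<^sub>k(u)\<close>. By definition
  \<open>a(v\<^sub>k(u), z) = a(u, Q\<^sub>k z)\<close> on \<open>V\<^sub>k\<close>. Taking \<open>z = v\<^sub>k(y)\<close> and summing over \<open>k\<close> gives
  \<open>a(T u, y) = \<Sum>\<^sub>k a(v\<^sub>k(u), v\<^sub>k(y))\<close>, on which everything rests. The right-hand side is
  symmetric in \<open>u\<close> and \<open>y\<close>, so \<open>T\<close> is self-adjoint for the inner product \<open>a\<close> on \<open>X\<close>, and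
  \<open>a(T u, u)\<close> is the total energy of the local solutions.

  From above: the local solutions have minimal energy among the elements of \<open>V\<^sub>k\<close> with the same
  image (\<open>local_solution_minimal_energy\<close>), so the local stability \<open>(ii)\<close> applies to them. By the
  strengthened Cauchy--Schwarz inequality \<open>(iii)\<close>, \<open>a(T u, T u)\<close> is at most a quadratic form
  with matrix \<open>\<E>\<close> in the norms of the \<open>Q\<^sub>k v\<^sub>k(u)\<close>, and such a form is at most \<open>\<rho>(\<E>)\<close> times the
  sum of squares (\<open>quadratic_form_le_spectral_radius\<close>). Together,
  \<open>a(T u, T u) \<le> \<omega> \<rho>(\<E>) a(T u, u)\<close>.

  From below: let \<open>w\<^sub>k\<close> be the stable decomposition \<open>(i)\<close> of \<open>u\<close>. Then
  \<open>a(u, u) = \<Sum>\<^sub>k a(u, Q\<^sub>k w\<^sub>k) = \<Sum>\<^sub>k a(v\<^sub>k(u), w\<^sub>k)\<close>, and the Cauchy--Schwarz inequality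
  for this sum gives \<open>a(u, u) \<le> C\<^sub>0 a(T u, u)\<close>.

  For an eigenvector these two inequalities say \<open>\<lambda> \<le> \<omega> \<rho>(\<E>)\<close> and \<open>1 \<le> C\<^sub>0 \<lambda>\<close>. To apply
  them to the largest and the smallest eigenvalue one needs that these exist, that is, that the
  set of eigenvalues is finite and nonempty (\<open>eigenvalues_finite_nonempty\<close>). Both this and the
  bound by the spectral radius come from a single fact: the maximum of a quadratic form on the
  unit sphere is attained at an eigenvector (\<open>symmetric_matrix_top_eigenvector\<close>). The abstract
  space \<open>X\<close> is reduced to coordinates by an \<open>a\<close>-orthonormal basis.\<close>


section \<open>Extremal eigenvectors of symmetric matrices\<close>

text \<open>The quadratic form attains its maximum \<open>\<mu>\<close> on the compact unit sphere, so
  \<open>g(y) = \<mu> |y|\<^sup>2 - q(y)\<close> is nonnegative and vanishes at the maximizer \<open>x\<close>. Moving from \<open>x\<close> in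
  the direction of the residual \<open>P x - \<mu> x\<close> would make \<open>g\<close> negative to first order unless the
  residual is zero.\<close>

lemma symmetric_matrix_top_eigenvector:
  fixes P :: "'i \<Rightarrow> 'i \<Rightarrow> real"
  assumes I: "finite I" "I \<noteq> {}"
    and sym: "\<And>i j. i \<in> I \<Longrightarrow> j \<in> I \<Longrightarrow> P i j = P j i"
  obtains x \<mu> where "(\<Sum>i\<in>I. (x i)\<^sup>2) = 1"
    and "\<And>i. i \<in> I \<Longrightarrow> (\<Sum>j\<in>I. P i j * x j) = \<mu> * x i"
    and "\<And>y. (\<Sum>i\<in>I. \<Sum>j\<in>I. P i j * y i * y j) \<le> \<mu> * (\<Sum>i\<in>I. (y i)\<^sup>2)"
proof -
  define q where "q y = (\<Sum>i\<in>I. \<Sum>j\<in>I. P i j * y i * y j)" for y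
  define n where "n y = (\<Sum>i\<in>I. (y i)\<^sup>2)" for y :: "'i \<Rightarrow> real"
  \<comment> \<open>Coordinates outside \<open>I\<close> are set to zero: otherwise the sphere would not be compact in the
    product topology on the functions on the whole type.\<close>
  define S where "S = {y. (\<forall>i. i \<notin> I \<longrightarrow> y i = 0) \<and> n y = 1}"
  have "compact (PiE UNIV (\<lambda>_::'i. {-1..1::real}))"
    using compactin_PiE[of "\<lambda>_. euclidean" UNIV "\<lambda>_::'i. {-1..1::real}"]
    by (simp add: euclidean_product_topology)
  moreover have "closed S"
  proof -
    have "S = (\<Inter>i\<in>-I. {y. y i = 0}) \<inter> {y. n y = 1}"
      unfolding S_def by auto
    moreover have "closed {y::'i \<Rightarrow> real. y i = 0}" for i
      by (intro closed_Collect_eq continuous_on_product_coordinates continuous_on_const)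
    moreover have "closed {y::'i \<Rightarrow> real. n y = 1}"
      unfolding n_def
      by (intro closed_Collect_eq continuous_intros continuous_on_product_coordinates)
    ultimately show ?thesis by (simp only:) (intro closed_Int closed_INT; simp)
  qed
  moreover have "S \<subseteq> PiE UNIV (\<lambda>_. {-1..1})"
  proof
    fix y assume y: "y \<in> S"
    have "\<bar>y i\<bar> \<le> 1" for i
    proof (cases "i \<in> I")
      case True
      then have "(y i)\<^sup>2 \<le> n y"
        unfolding n_def using I by (intro member_le_sum) auto
      then show ?thesis using y by (simp add: S_def abs_square_le_1)
    qed (use y in \<open>simp add: S_def\<close>)
    then show "y \<in> PiE UNIV (\<lambda>_. {-1..1})" by (auto simp: abs_le_iff minus_le_iff)
  qed
  ultimately have "compact S"
    by (metis compact_Int_closed inf.absorb_iff2)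
  moreover have "S \<noteq> {}"
  proof -
    obtain i where "i \<in> I" using I by auto
    then have "(\<lambda>j. if j = i then 1 else 0) \<in> S"
      using I by (simp add: S_def n_def if_distrib[of "\<lambda>t. t\<^sup>2"] cong: if_cong)
    then show ?thesis by auto
  qed
  moreover have "continuous_on S q"
    unfolding q_def
    by (intro continuous_intros continuous_on_subset[OF continuous_on_product_coordinates]) auto
  ultimately obtain x where x: "x \<in> S" and max: "\<And>y. y \<in> S \<Longrightarrow> q y \<le> q x"
    by (meson continuous_attains_sup)
  have bound: "q y \<le> q x * n y" for y
  proof (cases "n y = 0")
    case True
    then have "\<forall>i\<in>I. y i = 0"
      unfolding n_def using I by (simp add: sum_nonneg_eq_0_iff)
    then show ?thesis using True by (simp add: q_def)
  next
    case False
    then have pos: "n y > 0"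
      unfolding n_def by (simp add: sum_nonneg less_le)
    define s where "s = inverse (sqrt (n y))"
    have s2: "s\<^sup>2 * n y = 1"
      using pos by (simp add: s_def power_inverse)
    let ?y = "\<lambda>i. if i \<in> I then s * y i else 0"
    have "n ?y = s\<^sup>2 * n y"
      unfolding n_def sum_distrib_left by (intro sum.cong) (auto simp: power_mult_distrib)
    then have "q ?y \<le> q x"
      using s2 by (intro max) (simp add: S_def)
    moreover have "q ?y = s\<^sup>2 * q y"
      unfolding q_def sum_distrib_left
      by (intro sum.cong) (auto simp: power2_eq_square)
    ultimately have "s\<^sup>2 * q y * n y \<le> q x * n y"
      using pos by (intro mult_right_mono) auto
    moreover have "s\<^sup>2 * q y * n y = q y"
      using s2 by (simp add: mult.commute mult.left_commute)
    ultimately show ?thesis by simp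
  qed
  \<comment> \<open>The maximum \<open>\<mu>\<close> is \<open>q x\<close>, and \<open>r\<close> is the residual of \<open>x\<close> as an eigenvector.\<close>
  define r where "r i = (\<Sum>j\<in>I. P i j * x j) - q x * x i" for i
  have nx: "n x = 1" using x by (simp add: S_def)
  have cross: "2 * t * n r \<le> t\<^sup>2 * (q x * n r - q r)" for t
  proof -
    let ?z = "\<lambda>i. x i + t * r i"
    have b: "(\<Sum>i\<in>I. \<Sum>j\<in>I. P i j * r i * x j) = (\<Sum>i\<in>I. r i * (\<Sum>j\<in>I. P i j * x j))"
      unfolding sum_distrib_left by (intro sum.cong) auto
    have c: "(\<Sum>i\<in>I. \<Sum>j\<in>I. P i j * x i * r j) = (\<Sum>i\<in>I. \<Sum>j\<in>I. P i j * r i * x j)"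
      by (subst sum.swap) (intro sum.cong refl, simp add: sym)
    have "q ?z = q x + t * (\<Sum>i\<in>I. \<Sum>j\<in>I. P i j * x i * r j)
        + t * (\<Sum>i\<in>I. \<Sum>j\<in>I. P i j * r i * x j) + t\<^sup>2 * q r"
      unfolding q_def sum_distrib_left sum.distrib[symmetric]
      by (intro sum.cong refl) (simp add: algebra_simps power2_eq_square)
    then have qz: "q ?z = q x + 2 * t * (\<Sum>i\<in>I. r i * (\<Sum>j\<in>I. P i j * x j)) + t\<^sup>2 * q r"
      using b c by simp
    have nz: "n ?z = n x + 2 * t * (\<Sum>i\<in>I. r i * x i) + t\<^sup>2 * n r"
      unfolding n_def sum_distrib_left sum.distrib[symmetric]
      by (intro sum.cong refl) (simp add: algebra_simps power2_eq_square)
    have nr: "n r = (\<Sum>i\<in>I. r i * (\<Sum>j\<in>I. P i j * x j)) - q x * (\<Sum>i\<in>I. r i * x i)"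
      unfolding n_def sum_distrib_left[of "q x"] sum_subtractf[symmetric]
      by (intro sum.cong refl) (simp add: r_def algebra_simps power2_eq_square)
    show ?thesis
      using bound[of ?z] unfolding qz nz nx nr by (simp add: algebra_simps)
  qed
  have "n r = 0"
  proof (rule ccontr)
    assume "n r \<noteq> 0"
    then have pos: "n r > 0" unfolding n_def by (simp add: sum_nonneg less_le)
    define d where "d = q x * n r - q r"
    have d: "d \<ge> 0" using bound[of r] by (simp add: d_def)
    \<comment> \<open>Any positive step with \<open>t d < 2 n r\<close> contradicts \<open>cross\<close>; the summand 1 keeps the
      denominator nonzero.\<close>
    define t where "t = n r / (d + 1)"
    have t: "t > 0" using pos d by (simp add: t_def)
    have "2 * t * n r \<le> t * (t * d)" using cross[of t] by (simp add: d_def power2_eq_square)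
    then have "2 * n r \<le> t * d" using t by (simp add: mult.assoc mult.left_commute)
    also have "t * d \<le> n r"
      using pos d by (simp add: t_def field_simps)
    finally show False using pos by simp
  qed
  then have "\<forall>i\<in>I. r i = 0"
    unfolding n_def using I by (simp add: sum_nonneg_eq_0_iff)
  then show ?thesis
    using that[of x "q x"] nx bound by (simp add: r_def q_def n_def)
qed

text \<open>The maximum of the Rayleigh quotient is a real eigenvalue of \<open>E\<close>, hence also an eigenvalue of
  the complexified matrix, and so at most its spectral radius.\<close>

lemma quadratic_form_le_spectral_radius:
  fixes E :: "real mat" and y :: "nat \<Rightarrow> real"
  assumes E: "E \<in> carrier_mat n n" "transpose_mat E = E" and n: "n > 0"
  shows "(\<Sum>i<n. \<Sum>j<n. E $$ (i, j) * y i * y j)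
    \<le> spectral_radius (map_mat complex_of_real E) * (\<Sum>i<n. (y i)\<^sup>2)"
proof -
  have sym: "E $$ (i, j) = E $$ (j, i)" if "i < n" "j < n" for i j
    using that E by (metis carrier_matD index_transpose_mat(1))
  obtain x \<mu> where x: "(\<Sum>i<n. (x i)\<^sup>2) = 1"
    and eig: "\<And>i. i < n \<Longrightarrow> (\<Sum>j<n. E $$ (i, j) * x j) = \<mu> * x i"
    and le: "\<And>y. (\<Sum>i<n. \<Sum>j<n. E $$ (i, j) * y i * y j) \<le> \<mu> * (\<Sum>i<n. (y i)\<^sup>2)"
    using symmetric_matrix_top_eigenvector[of "{..<n}" "\<lambda>i j. E $$ (i, j)"] sym n
    by (auto simp: lessThan_empty_iff)
  define v where "v = vec n (\<lambda>i. complex_of_real (x i))"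
  let ?E = "map_mat complex_of_real E"
  have "?E *\<^sub>v v = complex_of_real \<mu> \<cdot>\<^sub>v v"
  proof (rule eq_vecI)
    fix i assume "i < dim_vec (complex_of_real \<mu> \<cdot>\<^sub>v v)"
    then have i: "i < n" by (simp add: v_def)
    have "(?E *\<^sub>v v) $ i = (\<Sum>j<n. complex_of_real (E $$ (i, j) * x j))"
      using i E by (simp add: v_def scalar_prod_def lessThan_atLeast0)
    also have "\<dots> = complex_of_real (\<mu> * x i)"
      using eig[OF i] by (simp only: of_real_sum[symmetric])
    finally show "(?E *\<^sub>v v) $ i = (complex_of_real \<mu> \<cdot>\<^sub>v v) $ i"
      using i by (simp add: v_def)
  qed (use E in \<open>simp add: v_def\<close>)
  moreover have "v \<noteq> 0\<^sub>v n"
  proof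
    assume "v = 0\<^sub>v n"
    then have "v $ i = 0" if "i < n" for i using that by simp
    then have "x i = 0" if "i < n" for i using that by (simp add: v_def)
    then show False using x by simp
  qed
  ultimately have "eigenvalue ?E (complex_of_real \<mu>)"
    using E unfolding eigenvalue_def eigenvector_def by (intro exI[of _ v]) (simp add: v_def)
  then have "norm (complex_of_real \<mu>) \<le> spectral_radius ?E"
    using spectral_radius_mem_max(2)[of ?E n] E n
    unfolding spectrum_def by (metis image_eqI map_carrier_mat mem_Collect_eq)
  then have "\<mu> * (\<Sum>i<n. (y i)\<^sup>2) \<le> spectral_radius ?E * (\<Sum>i<n. (y i)\<^sup>2)"
    by (intro mult_right_mono) (auto simp: sum_nonneg)
  then show ?thesis using le[of y] by linarith
qed


section \<open>Inner products on finite-dimensional subspaces\<close>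

text \<open>The forms of interest are controlled only on a subspace of the ambient type, so the usual rules
  for bilinear forms are derived relative to \<open>S\<close>.\<close>

locale symmetric_form =
  fixes S :: "'w::real_vector set" and a :: "'w \<Rightarrow> 'w \<Rightarrow> real"
  assumes subspace: "Real_Vector_Spaces.subspace S"
    and bilinear: "bilinear_form_on S a"
    and symmetric: "symmetric_on S a"
begin

lemma commute: "x \<in> S \<Longrightarrow> y \<in> S \<Longrightarrow> a x y = a y x"
  using symmetric by (simp add: symmetric_on_def)

lemma scale_left: "x \<in> S \<Longrightarrow> y \<in> S \<Longrightarrow> a (c *\<^sub>R x) y = c * a x y"
  using bilinear by (simp add: bilinear_form_on_def linear_on_def)

lemma add_left: "x \<in> S \<Longrightarrow> y \<in> S \<Longrightarrow> z \<in> S \<Longrightarrow> a (x + y) z = a x z + a y z"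
  using bilinear by (simp add: bilinear_form_on_def linear_on_def)

lemma diff_left: "x \<in> S \<Longrightarrow> y \<in> S \<Longrightarrow> z \<in> S \<Longrightarrow> a (x - y) z = a x z - a y z"
  using add_left[of x "(-1) *\<^sub>R y" z] scale_left[of y z "-1"] subspace
  by (simp add: real_vector.subspace_neg)

lemma zero_left: "y \<in> S \<Longrightarrow> a 0 y = 0"
  using scale_left[of 0 y 0] subspace by (simp add: real_vector.subspace_0)

lemma scale_right: "x \<in> S \<Longrightarrow> y \<in> S \<Longrightarrow> a x (c *\<^sub>R y) = c * a x y"
  using bilinear by (simp add: bilinear_form_on_def linear_on_def)

lemma add_right: "x \<in> S \<Longrightarrow> y \<in> S \<Longrightarrow> z \<in> S \<Longrightarrow> a x (y + z) = a x y + a x z"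
  using bilinear by (simp add: bilinear_form_on_def linear_on_def)

lemma diff_right: "x \<in> S \<Longrightarrow> y \<in> S \<Longrightarrow> z \<in> S \<Longrightarrow> a x (y - z) = a x y - a x z"
  using diff_left[of y z x] subspace commute by (simp add: real_vector.subspace_diff)

lemma sum_left:
  assumes "\<And>i. i \<in> I \<Longrightarrow> f i \<in> S" "y \<in> S"
  shows "a (\<Sum>i\<in>I. f i) y = (\<Sum>i\<in>I. a (f i) y)"
  using assms
  by (induction I rule: infinite_finite_induct)
    (auto simp: zero_left add_left real_vector.subspace_sum[OF subspace])

lemma sum_right:
  assumes "\<And>i. i \<in> I \<Longrightarrow> f i \<in> S" "y \<in> S"
  shows "a y (\<Sum>i\<in>I. f i) = (\<Sum>i\<in>I. a y (f i))"
  using assms commute[of y] sum_left[of I f y] real_vector.subspace_sum[OF subspace, of I f]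
  by simp

end

locale inner_product_form = symmetric_form +
  assumes finite_dim: "finite_dim_subspace S"
    and pos_def: "pos_def_on S a"
begin

lemma pos: "x \<in> S \<Longrightarrow> x \<noteq> 0 \<Longrightarrow> 0 < a x x"
  using pos_def by (simp add: pos_def_on_def)

lemma nonneg: "x \<in> S \<Longrightarrow> 0 \<le> a x x"
  using pos[of x] zero_left[of 0] by (cases "x = 0") auto

lemma eq_if_same_pairings:
  assumes "x \<in> S" "y \<in> S" "\<And>z. z \<in> S \<Longrightarrow> a x z = a y z"
  shows "x = y"
proof (rule ccontr)
  assume "x \<noteq> y"
  have "x - y \<in> S" using assms subspace by (simp add: real_vector.subspace_diff)
  moreover from this have "a (x - y) (x - y) = 0" using assms by (simp add: diff_left)
  ultimately show False using pos[of "x - y"] \<open>x \<noteq> y\<close> by simp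
qed

lemma sum_orthonormal:
  assumes on: "\<And>b c. b \<in> B \<Longrightarrow> c \<in> B \<Longrightarrow> a b c = (if b = c then 1 else 0)"
    and "finite B" "B \<subseteq> S" "b \<in> B"
  shows "a (\<Sum>c\<in>B. f c *\<^sub>R c) b = f b"
proof -
  have bS: "c \<in> S" if "c \<in> B" for c using assms that by auto
  have "a (\<Sum>c\<in>B. f c *\<^sub>R c) b = (\<Sum>c\<in>B. a (f c *\<^sub>R c) b)"
    using bS assms subspace by (intro sum_left) (auto simp: real_vector.subspace_scale)
  also have "\<dots> = (\<Sum>c\<in>B. if c = b then f c else 0)"
    using bS on \<open>b \<in> B\<close> by (intro sum.cong refl) (simp add: scale_left)
  finally show ?thesis using assms by simp
qed

text \<open>Gram--Schmidt orthogonalization, one vector of a finite spanning set at a time.\<close>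

lemma orthonormal_basis:
  obtains B where "finite B" "B \<subseteq> S" "Real_Vector_Spaces.span B = S"
    "\<And>b c. b \<in> B \<Longrightarrow> c \<in> B \<Longrightarrow> a b c = (if b = c then 1 else 0)"
proof -
  obtain F where F: "finite F" "Real_Vector_Spaces.span F = S"
    using finite_dim by (auto simp: finite_dim_subspace_def)
  have "\<exists>B. finite B \<and> B \<subseteq> S \<and> Real_Vector_Spaces.span B = Real_Vector_Spaces.span G \<and>
      (\<forall>b\<in>B. \<forall>c\<in>B. a b c = (if b = c then 1 else 0))" if "finite G" "G \<subseteq> S" for G
    using that
  proof (induction G)
    case empty
    then show ?case by (intro exI[of _ "{}"]) simp
  next
    case (insert x G)
    then obtain B where B: "finite B" "B \<subseteq> S"
      "Real_Vector_Spaces.span B = Real_Vector_Spaces.span G"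
      "\<And>b c. b \<in> B \<Longrightarrow> c \<in> B \<Longrightarrow> a b c = (if b = c then 1 else 0)" by auto
    define p where "p = (\<Sum>b\<in>B. a x b *\<^sub>R b)"
    define e where "e = x - p"
    have xS: "x \<in> S" using insert by simp
    have bS: "b \<in> S" if "b \<in> B" for b using B that by auto
    have pB: "p \<in> Real_Vector_Spaces.span B"
      unfolding p_def
      by (intro real_vector.span_sum real_vector.span_scale real_vector.span_base)
    have pS: "p \<in> S"
      unfolding p_def using subspace bS
      by (intro real_vector.subspace_sum real_vector.subspace_scale) auto
    have eS: "e \<in> S"
      unfolding e_def using subspace xS pS by (simp add: real_vector.subspace_diff)
    have orth: "a e b = 0" if "b \<in> B" for b
      using sum_orthonormal[OF B(4) B(1,2) that, of "a x"] xS pS bS[OF that]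
      by (simp add: e_def diff_left p_def[symmetric])
    have span_e: "Real_Vector_Spaces.span (insert e B) = Real_Vector_Spaces.span (insert x G)"
    proof -
      have "Real_Vector_Spaces.span (insert e B) = Real_Vector_Spaces.span (insert x B)"
        by (rule real_vector.eq_span_insert_eq) (use pB in \<open>simp add: e_def real_vector.span_neg\<close>)
      also have "\<dots> = Real_Vector_Spaces.span (insert x G)"
        using B(3) by (simp add: real_vector.span_insert)
      finally show ?thesis .
    qed
    show ?case
    proof (cases "e = 0")
      case True
      then show ?thesis using B span_e by (intro exI[of _ B]) auto
    next
      case False
      define s where "s = inverse (sqrt (a e e))"
      have s: "s \<noteq> 0" "s * s * a e e = 1"
        using pos[OF eS False] by (auto simp: s_def field_simps)
      have "a (s *\<^sub>R e) (s *\<^sub>R e) = 1"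
        using s eS subspace by (simp add: scale_left scale_right real_vector.subspace_scale)
      moreover have "a (s *\<^sub>R e) b = 0" "a b (s *\<^sub>R e) = 0" if "b \<in> B" for b
        using orth[OF that] commute[OF eS bS[OF that]] eS bS[OF that]
        by (simp_all add: scale_left scale_right)
      moreover have "s *\<^sub>R e \<notin> B"
        using calculation by force
      moreover have "Real_Vector_Spaces.span (insert (s *\<^sub>R e) B)
          = Real_Vector_Spaces.span (insert e B)"
      proof -
        have "s *\<^sub>R e \<in> Real_Vector_Spaces.span (insert e B)"
          by (intro real_vector.span_scale real_vector.span_base) simp
        moreover have "e = inverse s *\<^sub>R (s *\<^sub>R e)" using s by simp
        then have "e \<in> Real_Vector_Spaces.span (insert (s *\<^sub>R e) B)"
          by (metis real_vector.span_scale real_vector.span_base insertI1)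
        ultimately show ?thesis
          unfolding real_vector.span_eq by (auto intro: real_vector.span_base)
      qed
      ultimately show ?thesis
        using B span_e eS subspace
        by (intro exI[of _ "insert (s *\<^sub>R e) B"]) (auto simp: real_vector.subspace_scale)
    qed
  qed
  from this[of F] F obtain B where "finite B" "B \<subseteq> S" "Real_Vector_Spaces.span B = S"
    "\<And>b c. b \<in> B \<Longrightarrow> c \<in> B \<Longrightarrow> a b c = (if b = c then 1 else 0)"
    using real_vector.span_superset by metis
  then show ?thesis using that by blast
qed

lemma independent_if_orthogonal:
  assumes A: "A \<subseteq> S" "0 \<notin> A"
    and orth: "\<And>x y. x \<in> A \<Longrightarrow> y \<in> A \<Longrightarrow> x \<noteq> y \<Longrightarrow> a x y = 0"
  shows "\<not> Real_Vector_Spaces.dependent A"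
proof
  assume "Real_Vector_Spaces.dependent A"
  then obtain t c w where t: "finite t" "t \<subseteq> A"
    "(\<Sum>v\<in>t. c v *\<^sub>R v) = 0" "w \<in> t" "c w \<noteq> 0"
    unfolding real_vector.dependent_explicit by blast
  have tS: "v \<in> S" if "v \<in> t" for v using A t that by auto
  have "a (\<Sum>v\<in>t. c v *\<^sub>R v) w = (\<Sum>v\<in>t. a (c v *\<^sub>R v) w)"
    using tS t(4) subspace by (intro sum_left) (auto simp: real_vector.subspace_scale)
  also have "\<dots> = (\<Sum>v\<in>t. if v = w then c w * a w w else 0)"
    using t orth tS by (intro sum.cong refl) (auto simp: scale_left subset_iff)
  finally have "c w * a w w = 0" using t zero_left[OF tS[OF t(4)]] by simp
  moreover have "w \<noteq> 0" using A t by auto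
  ultimately show False using t(5) pos[OF tS[OF t(4)]] by simp
qed

text \<open>In an orthonormal basis the representing vector has the values of \<open>f\<close> on the basis as its
  coordinates.\<close>

lemma riesz_representation:
  assumes f: "linear_on S f"
  shows "\<exists>!v. v \<in> S \<and> (\<forall>z\<in>S. a v z = f z)"
proof -
  obtain B where B: "finite B" "B \<subseteq> S" "Real_Vector_Spaces.span B = S"
    and on: "\<And>b c. b \<in> B \<Longrightarrow> c \<in> B \<Longrightarrow> a b c = (if b = c then 1 else 0)"
    using orthonormal_basis by blast
  define v where "v = (\<Sum>b\<in>B. f b *\<^sub>R b)"
  have vS: "v \<in> S"
    unfolding v_def using subspace B
    by (intro real_vector.subspace_sum real_vector.subspace_scale) auto
  have base: "a v b = f b" if "b \<in> B" for b
    unfolding v_def using on B(1,2) that by (rule sum_orthonormal)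
  have f0: "f 0 = 0"
    using f real_vector.subspace_0[OF subspace] unfolding linear_on_def
    by (metis scaleR_zero_left)
  have "a v z = f z" if "z \<in> Real_Vector_Spaces.span B" for z
  proof -
    have "z \<in> S \<and> a v z = f z"
      using that
    proof (induction rule: real_vector.span_induct_alt)
      case base
      then show ?case
        using f0 vS zero_left[OF vS] commute[of v 0] real_vector.subspace_0[OF subspace] by simp
    next
      case (step c x y)
      then show ?case
        using B f vS subspace base
        by (auto simp: add_right scale_right linear_on_def subset_iff
            real_vector.subspace_scale real_vector.subspace_add)
    qed
    then show ?thesis by simp
  qed
  then show ?thesis
    using vS B eq_if_same_pairings by (intro ex1I[of _ v]) auto
qed

text \<open>This makes the maximum and the minimum of the set of eigenvalues meaningful. An eigenvector
  exists because the matrix of \<open>T\<close> in an orthonormal basis is symmetric. There are only finitely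
  many eigenvalues because eigenvectors for distinct eigenvalues are orthogonal, hence linearly
  independent.\<close>

lemma eigenvalues_finite_nonempty:
  assumes nz: "S \<noteq> {0}" and T: "T ` S \<subseteq> S"
    and bil: "bilinear_form_on S (\<lambda>x y. a (T x) y)"
    and sym: "symmetric_on S (\<lambda>x y. a (T x) y)"
  shows "finite (eigenvalues_on S T)" "eigenvalues_on S T \<noteq> {}"
proof -
  interpret T: symmetric_form S "\<lambda>x y. a (T x) y"
    using subspace bil sym by unfold_locales
  obtain B where B: "finite B" "B \<subseteq> S" "Real_Vector_Spaces.span B = S"
    and on: "\<And>b c. b \<in> B \<Longrightarrow> c \<in> B \<Longrightarrow> a b c = (if b = c then 1 else 0)"
    using orthonormal_basis by blast
  have bS: "b \<in> S" if "b \<in> B" for b using B that by auto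
  have TS: "T x \<in> S" if "x \<in> S" for x using T that by auto
  have "B \<noteq> {}" using B nz by auto
  then obtain x \<mu> where x: "(\<Sum>b\<in>B. (x b)\<^sup>2) = 1"
    and eig: "\<And>b. b \<in> B \<Longrightarrow> (\<Sum>c\<in>B. a (T b) c * x c) = \<mu> * x b"
    by (rule symmetric_matrix_top_eigenvector[OF B(1), of "\<lambda>b c. a (T b) c"])
      (use T.commute bS in auto)
  define u where "u = (\<Sum>b\<in>B. x b *\<^sub>R b)"
  have xb: "x b *\<^sub>R b \<in> S" if "b \<in> B" for b
    using subspace bS[OF that] by (rule real_vector.subspace_scale)
  have uS: "u \<in> S"
    unfolding u_def using subspace xb by (intro real_vector.subspace_sum)
  have ub: "a u b = x b" if "b \<in> B" for b
    unfolding u_def using on B(1,2) that by (rule sum_orthonormal)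
  have Tub: "a (T u) b = \<mu> * x b" if "b \<in> B" for b
  proof -
    have "a (T u) b = (\<Sum>c\<in>B. x c * a (T c) b)"
      unfolding u_def using xb bS that by (simp add: T.sum_left T.scale_left)
    also have "\<dots> = (\<Sum>c\<in>B. a (T b) c * x c)"
      using T.commute bS that by (intro sum.cong) auto
    finally show ?thesis using eig[OF that] by simp
  qed
  have "T u = \<mu> *\<^sub>R u"
  proof (rule eq_if_same_pairings)
    show "T u \<in> S" "\<mu> *\<^sub>R u \<in> S"
      using TS uS subspace by (auto intro: real_vector.subspace_scale)
    fix z assume "z \<in> S"
    then have "z \<in> Real_Vector_Spaces.span B" using B by simp
    then have "z \<in> S \<and> a (T u) z = a (\<mu> *\<^sub>R u) z"
    proof (induction rule: real_vector.span_induct_alt)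
      case base
      then show ?case
        using \<open>T u \<in> S\<close> \<open>\<mu> *\<^sub>R u \<in> S\<close> zero_left commute[of _ 0] real_vector.subspace_0[OF subspace]
        by simp
    next
      case (step c b y)
      then show ?case
        using \<open>T u \<in> S\<close> \<open>\<mu> *\<^sub>R u \<in> S\<close> bS Tub ub uS subspace
        by (auto simp: add_right scale_right scale_left
            real_vector.subspace_scale real_vector.subspace_add)
    qed
    then show "a (T u) z = a (\<mu> *\<^sub>R u) z" by simp
  qed
  moreover have "u \<noteq> 0"
  proof
    assume "u = 0"
    then have "x b = 0" if "b \<in> B" for b using ub[OF that] zero_left[OF bS[OF that]] by simp
    then show False using x by simp
  qed
  ultimately show "eigenvalues_on S T \<noteq> {}"
    using uS by (auto simp: eigenvalues_on_def)

  have "\<forall>l\<in>eigenvalues_on S T. \<exists>y. y \<in> S \<and> y \<noteq> 0 \<and> T y = l *\<^sub>R y"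
    by (auto simp: eigenvalues_on_def)
  from bchoice[OF this] obtain f
    where f: "\<And>l. l \<in> eigenvalues_on S T \<Longrightarrow> f l \<in> S \<and> f l \<noteq> 0 \<and> T (f l) = l *\<^sub>R f l"
    by auto
  have orth: "a (f l) (f m) = 0"
    if "l \<in> eigenvalues_on S T" "m \<in> eigenvalues_on S T" "l \<noteq> m" for l m
  proof -
    have "l * a (f l) (f m) = a (T (f l)) (f m)" using f that by (simp add: scale_left)
    also have "\<dots> = a (T (f m)) (f l)" using f that by (intro T.commute) auto
    also have "\<dots> = m * a (f l) (f m)"
      using f that commute[of "f m" "f l"] by (simp add: scale_left)
    finally show ?thesis using that by simp
  qed
  have inj: "inj_on f (eigenvalues_on S T)"
  proof (rule inj_onI, rule ccontr)
    fix l m assume "l \<in> eigenvalues_on S T" "m \<in> eigenvalues_on S T" "f l = f m" "l \<noteq> m"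
    then show False using orth[of l m] f[of m] pos[of "f m"] by simp
  qed
  have "\<not> Real_Vector_Spaces.dependent (f ` eigenvalues_on S T)"
  proof (rule independent_if_orthogonal)
    show "f ` eigenvalues_on S T \<subseteq> S" "0 \<notin> f ` eigenvalues_on S T" using f by force+
    fix x y assume "x \<in> f ` eigenvalues_on S T" "y \<in> f ` eigenvalues_on S T" "x \<noteq> y"
    then show "a x y = 0" using orth by blast
  qed
  moreover have "f ` eigenvalues_on S T \<subseteq> Real_Vector_Spaces.span B" using f B by auto
  ultimately have "finite (f ` eigenvalues_on S T)"
    using B real_vector.independent_span_bound by blast
  then show "finite (eigenvalues_on S T)" using inj by (rule finite_imageD)
qed

end

lemma finite_dim_subspace_subset:
  assumes W: "finite_dim_subspace W" and V: "Real_Vector_Spaces.subspace V" "V \<subseteq> W"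
  shows "finite_dim_subspace V"
proof -
  obtain F where F: "finite F" "Real_Vector_Spaces.span F = W"
    using W by (auto simp: finite_dim_subspace_def)
  obtain B where B: "B \<subseteq> V" "\<not> Real_Vector_Spaces.dependent B" "V \<subseteq> Real_Vector_Spaces.span B"
    using real_vector.basis_exists[of V] by metis
  then have "finite B" using F V real_vector.independent_span_bound[of F B] by auto
  then show ?thesis
    using B V real_vector.span_subspace[of B V] by (auto simp: finite_dim_subspace_def)
qed

lemma bilinear_form_on_subset:
  "bilinear_form_on W a \<Longrightarrow> S \<subseteq> W \<Longrightarrow> bilinear_form_on S a"
  by (auto simp: bilinear_form_on_def linear_on_def subset_iff)

lemma symmetric_on_subset: "symmetric_on W a \<Longrightarrow> S \<subseteq> W \<Longrightarrow> symmetric_on S a"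
  by (auto simp: symmetric_on_def)


section \<open>The local problems\<close>

context inner_product_form
begin

lemma local_solution:
  assumes "linear_on S (\<lambda>z. r (q z))"
  shows "local_solution a S q r \<in> S"
    and "z \<in> S \<Longrightarrow> a (local_solution a S q r) z = r (q z)"
  using theI'[OF riesz_representation, of "\<lambda>z. r (q z)"] assms unfolding local_solution_def by auto

text \<open>The pairing of the local solution \<open>v\<close> with \<open>z\<close> depends only on \<open>q z\<close>. If \<open>q z = q v\<close>, then
  \<open>z - v\<close> is orthogonal to \<open>v\<close>, and \<open>a v v \<le> a z z\<close> by Pythagoras.\<close>

lemma local_solution_minimal_energy:
  assumes lin: "linear_on S (\<lambda>z. r (q z))"
  shows "local_solution a S q r \<in> minimal_energy_set a S q"
proof -
  define v where "v = local_solution a S q r"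
  note v = local_solution[where r = r and q = q, OF lin, folded v_def]
  have "a v v \<le> a z z" if z: "z \<in> S" "q v = q z" for z
  proof -
    have "0 \<le> a (z - v) (z - v)"
      using z v subspace by (intro nonneg) (simp add: real_vector.subspace_diff)
    also have "\<dots> = a z z - 2 * a v z + a v v"
      using z v subspace commute[of z v]
      by (simp add: diff_left diff_right real_vector.subspace_diff)
    also have "a v z = a v v" using z v by simp
    finally show ?thesis by simp
  qed
  then show ?thesis
    using v(1) nonneg by (simp add: minimal_energy_set_def energy_norm_def flip: v_def)
qed

end


section \<open>The condition number bound\<close>

theorem theorem3:
  fixes X W :: "'w::real_vector set"
    and a :: "'w \<Rightarrow> 'w \<Rightarrow> real"
    and M :: nat
    and V :: "nat \<Rightarrow> 'w set"
    and Q :: "nat \<Rightarrow> 'w \<Rightarrow> 'w"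
    and C0 \<omega> :: real
    and E :: "real mat"
  assumes W: "finite_dim_subspace W"
    and X: "finite_dim_subspace X" "X \<subseteq> W" "X \<noteq> {0}"
    and a: "bilinear_form_on W a" "symmetric_on W a" "pos_semidef_on W a" "pos_def_on X a"
    and V: "\<And>k. k < M \<Longrightarrow> Real_Vector_Spaces.subspace (V k)"
      "\<And>k. k < M \<Longrightarrow> V k \<subseteq> W"
      "\<And>k. k < M \<Longrightarrow> pos_def_on (V k) a"
    and sum_V: "X \<subseteq> (\<Sum>k<M. V k)" "(\<Sum>k<M. V k) \<subseteq> W"
    and Q: "\<And>k. k < M \<Longrightarrow> linear_on (V k) (Q k)"
      "\<And>k. k < M \<Longrightarrow> Q k ` V k \<subseteq> X"
    and E: "E \<in> carrier_mat M M" "transpose_mat E = E"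
    and stable_decomposition:
      "\<forall>u\<in>X. \<exists>v. (\<forall>k<M. v k \<in> V k) \<and> u = (\<Sum>k<M. Q k (v k)) \<and>
        (\<Sum>k<M. (energy_norm a (v k))\<^sup>2) \<le> C0 * (energy_norm a u)\<^sup>2"
    and local_stability:
      "\<forall>k<M. \<forall>v\<in>minimal_energy_set a (V k) (Q k).
        (energy_norm a (Q k v))\<^sup>2 \<le> \<omega> * (energy_norm a v)\<^sup>2"
    and strengthened_Cauchy_Schwarz:
      "\<forall>z. (\<forall>k<M. z k \<in> Q k ` V k) \<longrightarrow>
        (\<forall>i<M. \<forall>j<M. a (z i) (z j) \<le> E $$ (i, j) * energy_norm a (z i) * energy_norm a (z j))"
  defines "BA \<equiv> preconditioner X a M V Q \<circ> form_op X a"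
  shows "lambda_max X BA / lambda_min X BA
    \<le> C0 * \<omega> * spectral_radius (map_mat complex_of_real E)"
proof -
  interpret X: inner_product_form X a
    using X a by unfold_locales
      (auto simp: finite_dim_subspace_def intro: bilinear_form_on_subset symmetric_on_subset)
  have Vk: "inner_product_form (V k) a" if "k < M" for k
    using V[OF that] W a finite_dim_subspace_subset bilinear_form_on_subset symmetric_on_subset
    by unfold_locales blast+
  define \<rho> where "\<rho> = spectral_radius (map_mat complex_of_real E)"
  define v where "v u k = local_solution a (V k) (Q k) (form_op X a u)" for u k
  have QX: "Q k z \<in> X" if "k < M" "z \<in> V k" for k z
    using Q(2)[OF that(1)] that(2) by auto
  have lin: "linear_on (V k) (\<lambda>z. form_op X a u (Q k z))" if "k < M" "u \<in> X" for k u
    using Q(1)[OF that(1)] QX[OF that(1)] that(2) X.subspace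
    by (simp add: linear_on_def form_op_def X.add_right X.scale_right
        real_vector.subspace_add real_vector.subspace_scale)
  have vV: "v u k \<in> V k" if "k < M" "u \<in> X" for u k
    unfolding v_def using inner_product_form.local_solution(1)[where q = "Q k" and r = "form_op X a u", OF Vk lin]
      that by blast
  have v_eq: "a (v u k) z = a u (Q k z)" if "k < M" "u \<in> X" "z \<in> V k" for u k z
    using inner_product_form.local_solution(2)[where q = "Q k" and r = "form_op X a u", OF Vk[OF that(1)] lin[OF that(1,2)] that(3)]
      QX[OF that(1,3)] by (simp add: v_def form_op_def)
  have BA: "BA u = (\<Sum>k<M. Q k (v u k))" if "u \<in> X" for u
  proof -
    have "form_op X a u \<in> dual_space X"
      using that X.subspace by (auto simp: dual_space_def form_op_def linear_on_def
          X.add_right X.scale_right real_vector.subspace_add real_vector.subspace_scale)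
    then show ?thesis by (simp add: BA_def preconditioner_def v_def)
  qed
  have BAX: "BA u \<in> X" if "u \<in> X" for u
    unfolding BA[OF that] using QX vV that by (intro real_vector.subspace_sum[OF X.subspace]) auto
  have pair: "a (BA u) y = (\<Sum>k<M. a (v u k) (v y k))" if "u \<in> X" "y \<in> X" for u y
  proof -
    have "a (BA u) y = (\<Sum>k<M. a (Q k (v u k)) y)"
      unfolding BA[OF that(1)] using QX vV that by (intro X.sum_left) auto
    also have "\<dots> = (\<Sum>k<M. a (v u k) (v y k))"
    proof (intro sum.cong refl)
      fix k assume "k \<in> {..<M}"
      then have k: "k < M" by simp
      interpret Vk: inner_product_form "V k" a by (rule Vk[OF k])
      show "a (Q k (v u k)) y = a (v u k) (v y k)"
        using v_eq[OF k that(2) vV[OF k that(1)]] vV[OF k] that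
          X.commute[OF that(2) QX[OF k vV[OF k that(1)]]] Vk.commute by simp
    qed
    finally show ?thesis .
  qed
  have sym: "symmetric_on X (\<lambda>x y. a (BA x) y)"
    unfolding symmetric_on_def
  proof (intro ballI)
    fix x y assume xy: "x \<in> X" "y \<in> X"
    have "a (v x k) (v y k) = a (v y k) (v x k)" if "k < M" for k
    proof -
      interpret Vk: inner_product_form "V k" a by (rule Vk[OF that])
      show ?thesis using Vk.commute vV xy that by simp
    qed
    then show "a (BA x) y = a (BA y) x" using xy by (simp add: pair)
  qed
  have bil: "bilinear_form_on X (\<lambda>x y. a (BA x) y)"
  proof -
    have right: "linear_on X (\<lambda>y. a (BA x) y)" if "x \<in> X" for x
      using BAX[OF that] X.add_right X.scale_right by (simp add: linear_on_def)
    moreover have "linear_on X (\<lambda>x. a (BA x) y)" if "y \<in> X" for y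
      using right[OF that] sym that X.subspace unfolding linear_on_def symmetric_on_def
      by (simp add: real_vector.subspace_add real_vector.subspace_scale)
    ultimately show ?thesis by (simp add: bilinear_form_on_def)
  qed
  have eigs: "finite (eigenvalues_on X BA)" "eigenvalues_on X BA \<noteq> {}"
    using X.eigenvalues_finite_nonempty[OF X(3) _ bil sym] BAX by auto

  \<comment> \<open>The spectral radius is a maximum over the spectrum, which is nonempty only for matrices of
    positive dimension.\<close>
  have M: "M > 0"
  proof (rule ccontr)
    assume "\<not> M > 0"
    then have "X \<subseteq> {0}" using sum_V(1) by (simp add: set_zero)
    then show False using X(3) real_vector.subspace_0[OF X.subspace] by auto
  qed
  have energy: "(energy_norm a z)\<^sup>2 = a z z" if "z \<in> W" for z
    using a(3) that by (simp add: pos_semidef_on_def energy_norm_def)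
  have VW: "z \<in> W" if "k < M" "z \<in> V k" for k z using V(2) that by auto
  have rho: "(\<Sum>i<M. \<Sum>j<M. E $$ (i, j) * y i * y j) \<le> \<rho> * (\<Sum>i<M. (y i)\<^sup>2)" for y
    unfolding \<rho>_def using E M by (rule quadratic_form_le_spectral_radius)
  have rho0: "\<rho> \<ge> 0"
  proof -
    have "\<rho> \<in> norm ` spectrum (map_mat complex_of_real E)"
      unfolding \<rho>_def using E M by (intro spectral_radius_mem_max(1)[of _ M]) auto
    then show ?thesis by auto
  qed

  have upper: "a (BA u) (BA u) \<le> \<omega> * \<rho> * a (BA u) u" if u: "u \<in> X" for u
  proof -
    let ?z = "\<lambda>k. Q k (v u k)"
    have zX: "?z k \<in> X" if "k < M" for k using QX vV u that by simp
    have "a (BA u) (BA u) = (\<Sum>i<M. \<Sum>j<M. a (?z i) (?z j))"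
    proof -
      have "a (BA u) (BA u) = (\<Sum>i<M. a (?z i) (BA u))"
        using X.sum_left[of "{..<M}" ?z "BA u"] zX BAX[OF u] BA[OF u] by simp
      also have "\<dots> = (\<Sum>i<M. \<Sum>j<M. a (?z i) (?z j))"
        using X.sum_right[of "{..<M}" ?z] zX BA[OF u] by (intro sum.cong refl) simp
      finally show ?thesis .
    qed
    also have "\<dots> \<le> (\<Sum>i<M. \<Sum>j<M. E $$ (i, j) * energy_norm a (?z i) * energy_norm a (?z j))"
      using strengthened_Cauchy_Schwarz[rule_format, of ?z] vV u by (intro sum_mono) auto
    also have "\<dots> \<le> \<rho> * (\<Sum>k<M. (energy_norm a (?z k))\<^sup>2)" by (rule rho)
    also have "\<dots> \<le> \<rho> * (\<Sum>k<M. \<omega> * a (v u k) (v u k))"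
    proof (intro mult_left_mono sum_mono rho0)
      fix k assume "k \<in> {..<M}"
      then have k: "k < M" by simp
      have "v u k \<in> minimal_energy_set a (V k) (Q k)"
        unfolding v_def
        by (rule inner_product_form.local_solution_minimal_energy
            [where q = "Q k" and r = "form_op X a u", OF Vk[OF k] lin[OF k u]])
      then show "(energy_norm a (?z k))\<^sup>2 \<le> \<omega> * a (v u k) (v u k)"
        using local_stability k energy[OF VW[OF k vV[OF k u]]] by fastforce
    qed
    also have "\<dots> = \<omega> * \<rho> * a (BA u) u"
      using pair[OF u u] by (simp add: sum_distrib_left[symmetric])
    finally show ?thesis .
  qed
  \<comment> \<open>Otherwise \<open>(i)\<close> would force all parts of a decomposition of any \<open>u\<close> to have energy zero, hence
    to vanish.\<close>
  have C0: "C0 > 0"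
  proof (rule ccontr)
    assume neg: "\<not> C0 > 0"
    obtain u where u: "u \<in> X" "u \<noteq> 0" using X(3) real_vector.subspace_0[OF X.subspace] by auto
    obtain w where w: "\<And>k. k < M \<Longrightarrow> w k \<in> V k" "u = (\<Sum>k<M. Q k (w k))"
      "(\<Sum>k<M. (energy_norm a (w k))\<^sup>2) \<le> C0 * (energy_norm a u)\<^sup>2"
      using stable_decomposition u by blast
    have "C0 * (energy_norm a u)\<^sup>2 \<le> 0" using neg by (simp add: mult_nonpos_nonneg)
    then have "(\<Sum>k<M. (energy_norm a (w k))\<^sup>2) = 0"
      using w(3) by (meson order.antisym order.trans sum_nonneg zero_le_power2)
    then have w0: "(energy_norm a (w k))\<^sup>2 = 0" if "k < M" for k
      using that by (simp add: sum_nonneg_eq_0_iff)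
    have "Q k (w k) = 0" if k: "k < M" for k
    proof -
      interpret Vk: inner_product_form "V k" a by (rule Vk[OF k])
      have "w k = 0"
        using w0[OF k] energy[OF VW[OF k w(1)[OF k]]] Vk.pos[OF w(1)[OF k]] by force
      then show ?thesis
        using Q(1)[OF k] w(1)[OF k] unfolding linear_on_def by (metis scaleR_zero_left)
    qed
    then show False using u w(2) by simp
  qed
  have lower: "a u u \<le> C0 * a (BA u) u" if u: "u \<in> X" for u
  proof -
    obtain w where w: "\<And>k. k < M \<Longrightarrow> w k \<in> V k" "u = (\<Sum>k<M. Q k (w k))"
      "(\<Sum>k<M. (energy_norm a (w k))\<^sup>2) \<le> C0 * (energy_norm a u)\<^sup>2"
      using stable_decomposition u by blast
    have "a u (\<Sum>k<M. Q k (w k)) = (\<Sum>k<M. a u (Q k (w k)))"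
      using QX w(1) u by (intro X.sum_right) auto
    then have uu: "a u u = (\<Sum>k<M. a (v u k) (w k))"
      using w(2)[symmetric] v_eq u w(1) by simp
    have ww: "(\<Sum>k<M. a (w k) (w k)) \<le> C0 * a u u"
      using w(3) energy VW w(1) u X(2) by (simp add: subset_iff)
    \<comment> \<open>Cauchy--Schwarz for the sum over \<open>k\<close>, in the form that expands
      \<open>a (C0 v - w) (C0 v - w) \<ge> 0\<close>; the weight \<open>C0\<close> is the one for which the bound
      \<open>ww\<close> leaves exactly the claim.\<close>
    have "0 \<le> C0\<^sup>2 * a (v u k) (v u k) - 2 * C0 * a (v u k) (w k) + a (w k) (w k)"
      if k: "k < M" for k
    proof -
      interpret Vk: inner_product_form "V k" a by (rule Vk[OF k])
      have s: "C0 *\<^sub>R v u k \<in> V k"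
        using vV[OF k u] Vk.subspace by (simp add: real_vector.subspace_scale)
      have "0 \<le> a (C0 *\<^sub>R v u k - w k) (C0 *\<^sub>R v u k - w k)"
        using s w(1)[OF k] Vk.subspace by (intro Vk.nonneg) (simp add: real_vector.subspace_diff)
      also have "\<dots> = C0\<^sup>2 * a (v u k) (v u k) - 2 * C0 * a (v u k) (w k) + a (w k) (w k)"
        using s vV[OF k u] w(1)[OF k] Vk.subspace Vk.commute[of "w k" "v u k"]
        by (simp add: Vk.diff_left Vk.diff_right Vk.scale_left Vk.scale_right
            real_vector.subspace_diff power2_eq_square algebra_simps)
      finally show ?thesis .
    qed
    then have "0 \<le> (\<Sum>k<M. C0\<^sup>2 * a (v u k) (v u k) - 2 * C0 * a (v u k) (w k) + a (w k) (w k))"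
      by (intro sum_nonneg) auto
    also have "\<dots> = C0\<^sup>2 * a (BA u) u - 2 * C0 * a u u + (\<Sum>k<M. a (w k) (w k))"
      by (simp add: sum.distrib sum_subtractf sum_distrib_left uu pair[OF u u])
    finally have "C0 * a u u \<le> C0 * (C0 * a (BA u) u)"
      using ww by (simp add: power2_eq_square algebra_simps)
    then show ?thesis using C0 by simp
  qed

  have bounds: "1 \<le> C0 * l" "l \<le> \<omega> * \<rho>" if l: "l \<in> eigenvalues_on X BA" for l
  proof -
    obtain u where u: "u \<in> X" "u \<noteq> 0" "BA u = l *\<^sub>R u"
      using l by (auto simp: eigenvalues_on_def)
    have pos: "a u u > 0" using X.pos u by simp
    have lu: "a (BA u) u = l * a u u" "a (BA u) (BA u) = l * (l * a u u)"
      using u BAX[OF u(1)] by (auto simp: X.scale_left X.scale_right)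
    show "1 \<le> C0 * l" using lower[OF u(1)] pos lu by (simp flip: mult.assoc)
    then have "0 < C0 * l" by simp
    then have l0: "l > 0" using C0 by (simp add: zero_less_mult_iff)
    have "l * (l * a u u) \<le> (\<omega> * \<rho>) * (l * a u u)" using upper[OF u(1)] lu by simp
    then show "l \<le> \<omega> * \<rho>" using l0 pos by simp
  qed
  have "lambda_max X BA \<in> eigenvalues_on X BA" "lambda_min X BA \<in> eigenvalues_on X BA"
    unfolding lambda_max_def lambda_min_def using eigs by auto
  then have max: "lambda_max X BA \<le> \<omega> * \<rho>" "1 \<le> C0 * lambda_max X BA"
    and min: "1 \<le> C0 * lambda_min X BA"
    using bounds by auto
  have pos: "lambda_min X BA > 0" "lambda_max X BA > 0"
    using min max(2) C0 by (smt (verit) mult_nonneg_nonpos)+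
  have "lambda_max X BA * 1 \<le> (\<omega> * \<rho>) * (C0 * lambda_min X BA)"
    using max min pos by (intro mult_mono) auto
  then show ?thesis
    using pos by (simp add: divide_le_eq \<rho>_def ac_simps)
qed

end
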